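(* Let $a\in\mathcal A$ be an agent. The following schemas are not valid, i.e. for each of them there are an instance (a choice of formula $\varphi$, where $\varphi$ occurs), an EGL-model $M$ and a state $s$ of $M$ at which the instance has value different from $1$: (1) $\neg B_a\bot$; (2) $B_a\varphi\to B_aB_a\varphi$; (3) $B_a\varphi\to\varphi$.
   Context: Fix a set $\mathcal P$ of atomic propositions and a set $\mathcal A$ of agents. Formulas: $\varphi ::= p \mid \bot \mid \varphi\wedge\varphi \mid \varphi\to\varphi \mid B_a\varphi$ with $p\in\mathcal P$, $a\in\mathcal A$; $\neg\varphi=\varphi\to\bot$. An EGL-model is $M=(S,(r_a)_{a\in\mathcal A},\pi)$ where $S$ is a non-empty countable set, each $r_a:S\times S\to[0,1]$, and $\pi:S\times\mathcal P\to[0,1]$. Values: $V_s(p)=\pi(s,p)$; $V_s(\bot)=0$; $V_s(\varphi\wedge\psi)=\min\{V_s(\varphi),V_s(\psi)\}$; $V_s(\varphi\to\psi)=1$ if $V_s(\varphi)\le V_s(\psi)$ and $=V_s(\psi)$ otherwise; $V_s(B_a\varphi)=\inf_{s'\in S}\max\{1-r_a(s,s'),V_{s'}(\varphi)\}$. A formula is valid if it has value $1$ at every state of every EGL-model. *)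

theory Defs
  imports Complex_Main "HOL-Library.Countable_Set"
begin

text \<open>The set of atomic propositions is the type \<open>'p\<close>, the set of agents the type \<open>'a\<close>.\<close>

datatype ('p, 'a) fm =
    Atom 'p
  | Bot  (\<open>\<^bold>\<bottom>\<close>)
  | Conj "('p, 'a) fm" "('p, 'a) fm"  (infixr \<open>\<^bold>\<and>\<close> 35)
  | Imp "('p, 'a) fm" "('p, 'a) fm"  (infixr \<open>\<^bold>\<longrightarrow>\<close> 25)
  | Bel 'a "('p, 'a) fm"

abbreviation Neg :: "('p, 'a) fm \<Rightarrow> ('p, 'a) fm"  (\<open>\<^bold>\<not> _\<close> [40] 40) where
  "\<^bold>\<not> \<phi> \<equiv> \<phi> \<^bold>\<longrightarrow> \<^bold>\<bottom>"

record ('s, 'p, 'a) model =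
  states :: "'s set"
  acc :: "'a \<Rightarrow> 's \<Rightarrow> 's \<Rightarrow> real"
  val :: "'s \<Rightarrow> 'p \<Rightarrow> real"

definition egl_model :: "('s, 'p, 'a) model \<Rightarrow> bool" where
  "egl_model M \<longleftrightarrow>
     states M \<noteq> {} \<and> countable (states M) \<and>
     (\<forall>a. \<forall>s\<in>states M. \<forall>t\<in>states M. acc M a s t \<in> {0..1}) \<and>
     (\<forall>s\<in>states M. \<forall>p. val M s p \<in> {0..1})"

text \<open>The infimum below is the one of the reals. In an EGL-model it is taken over a non-empty
  set of numbers in \<open>[0,1]\<close>, so it is the genuine infimum.\<close>

primrec fval :: "('s, 'p, 'a) model \<Rightarrow> ('p, 'a) fm \<Rightarrow> 's \<Rightarrow> real" where
  "fval M (Atom p) s = val M s p"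
| "fval M \<^bold>\<bottom> s = 0"
| "fval M (\<phi> \<^bold>\<and> \<psi>) s = min (fval M \<phi> s) (fval M \<psi> s)"
| "fval M (\<phi> \<^bold>\<longrightarrow> \<psi>) s = (if fval M \<phi> s \<le> fval M \<psi> s then 1 else fval M \<psi> s)"
| "fval M (Bel a \<phi>) s = (INF t\<in>states M. max (1 - acc M a s t) (fval M \<phi> t))"

text \<open>Quantification over all EGL-models cannot range over types inside a formula. Since state
  sets are countable, models whose states are natural numbers suffice; lemma \<open>valid_fval\<close>
  below shows that nothing is lost.\<close>

definition valid :: "('p, 'a) fm \<Rightarrow> bool" where
  "valid \<phi> \<longleftrightarrow>
     (\<forall>M :: (nat, 'p, 'a) model. egl_model M \<longrightarrow> (\<forall>s\<in>states M. fval M \<phi> s = 1))"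

lemma valid_fval:
  fixes M :: "('s, 'p, 'a) model"
  assumes "valid \<phi>" and M: "egl_model M" and s: "s \<in> states M"
  shows "fval M \<phi> s = 1"
proof -
  define f where "f = to_nat_on (states M)"
  define g where "g = from_nat_into (states M)"
  have gf: "g (f t) = t" if "t \<in> states M" for t
    using that M by (simp add: f_def g_def egl_model_def)
  define N :: "(nat, 'p, 'a) model" where
    "N = \<lparr>states = f ` states M, acc = (\<lambda>a m n. acc M a (g m) (g n)), val = (\<lambda>m. val M (g m))\<rparr>"
  have eq: "fval N \<psi> (f t) = fval M \<psi> t" if "t \<in> states M" for \<psi> t
    using that
  proof (induction \<psi> arbitrary: t)
    case (Bel a \<psi>)
    then have "(\<lambda>u. max (1 - acc M a (g (f t)) (g (f u))) (fval N \<psi> (f u))) ` states M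
        = (\<lambda>u. max (1 - acc M a t u) (fval M \<psi> u)) ` states M"
      by (intro image_cong) (simp_all add: gf)
    then show ?case by (simp add: N_def image_image)
  qed (simp_all add: N_def gf)
  have "egl_model N"
    using M by (auto simp: egl_model_def N_def gf)
  with assms(1) s have "fval N \<phi> (f s) = 1"
    by (auto simp: valid_def N_def)
  with eq[OF s] show ?thesis by simp
qed

end

theory Submission imports Defs
begin

text \<open>At a state without successors every belief holds vacuously, which refutes (1) and (3).
  For (2), let two states see each other but not themselves, and let an atom hold at just one of
  them: where it fails it is believed, but this belief is not believed.\<close>

definition isolated_point :: "(nat, 'p, 'a) model" where
  "isolated_point = \<lparr>states = {0}, acc = (\<lambda>_ _ _. 0), val = (\<lambda>_ _. 0)\<rparr>"

definition two_cycle :: "(nat, 'p, 'a) model" where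
  "two_cycle = \<lparr>states = {0, 1}, acc = (\<lambda>_ s t. if s = t then 0 else 1), val = (\<lambda>s _. real s)\<rparr>"

lemma egl_model_isolated_point: "egl_model isolated_point"
  by (simp add: egl_model_def isolated_point_def)

lemma egl_model_two_cycle: "egl_model two_cycle"
  by (simp add: egl_model_def two_cycle_def)

text \<open>Each state sees only the other one, so the infimum is a minimum of two terms. The maxima
  stay because no bounds on the values of an arbitrary \<open>\<phi>\<close> are assumed; this
  generality lets the lemma apply to nested beliefs.\<close>

lemma fval_two_cycle_Bel:
  "fval two_cycle (Bel a \<phi>) 0 = min (max 1 (fval two_cycle \<phi> 0)) (max 0 (fval two_cycle \<phi> 1))"
  "fval two_cycle (Bel a \<phi>) 1 = min (max 0 (fval two_cycle \<phi> 0)) (max 1 (fval two_cycle \<phi> 1))"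
  by (simp_all add: two_cycle_def cInf_eq_Min)

theorem proposition2p1:
  fixes a :: 'a
  shows "\<not> valid (\<^bold>\<not> Bel a \<^bold>\<bottom> :: ('p, 'a) fm) \<and>
    (\<exists>\<phi> :: ('p, 'a) fm. \<not> valid (Bel a \<phi> \<^bold>\<longrightarrow> Bel a (Bel a \<phi>))) \<and>
    (\<exists>\<phi> :: ('p, 'a) fm. \<not> valid (Bel a \<phi> \<^bold>\<longrightarrow> \<phi>))"
proof -
  \<comment> \<open>\<open>Neg\<close> abbreviates an implication, so this formula is also the third
    schema at \<open>\<phi> = Bot\<close>: one refutation settles both claims.\<close>
  have bot: "\<not> valid (Bel a \<^bold>\<bottom> \<^bold>\<longrightarrow> \<^bold>\<bottom> :: ('p, 'a) fm)"
  proof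
    assume "valid (Bel a \<^bold>\<bottom> \<^bold>\<longrightarrow> \<^bold>\<bottom> :: ('p, 'a) fm)"
    then have "fval isolated_point (Bel a \<^bold>\<bottom> \<^bold>\<longrightarrow> \<^bold>\<bottom> :: ('p, 'a) fm) 0 = 1"
      by (rule valid_fval[OF _ egl_model_isolated_point]) (simp add: isolated_point_def)
    then show False
      by (simp add: isolated_point_def)
  qed
  have "\<not> valid (Bel a (Atom p) \<^bold>\<longrightarrow> Bel a (Bel a (Atom p)))" for p :: 'p
  proof
    assume "valid (Bel a (Atom p) \<^bold>\<longrightarrow> Bel a (Bel a (Atom p)))"
    then have "fval two_cycle (Bel a (Atom p) \<^bold>\<longrightarrow> Bel a (Bel a (Atom p))) 0 = 1"
      by (rule valid_fval[OF _ egl_model_two_cycle]) (simp add: two_cycle_def)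
    moreover have "fval two_cycle (Atom p :: ('p, 'a) fm) 0 = 0"
        "fval two_cycle (Atom p :: ('p, 'a) fm) 1 = 1"
      by (simp_all add: two_cycle_def)
    \<comment> \<open>Belief swaps the two values of the atom, and a second belief swaps them back.
      Restricting the simplifier keeps \<open>Bel\<close> from unfolding into an infimum.\<close>
    then have "fval two_cycle (Bel a (Atom p)) 0 = 1"
        "fval two_cycle (Bel a (Bel a (Atom p))) 0 = 0"
      by (simp_all only: fval_two_cycle_Bel) simp_all
    ultimately show False
      by (simp only: fval.simps(4)) simp
  qed
  with bot show ?thesis by blast
qed

end
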